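(* Let $\mathbf{k}$ be a commutative ring and let $C$ be a $\mathbf{k}$-coalgebra. Let $g_1,g_2,\ldots,g_n$ be $n$ grouplike elements of $C$, and let $c_1,c_2,\ldots,c_n\in\mathbf{k}$. Assume that $\sum_{i=1}^{n}c_i g_i=0$. Then $$c_i\prod_{j\neq i}(g_i-g_j)=0\quad\text{in } \operatorname{Sym} C\qquad\text{for all } i\in\{1,2,\ldots,n\},$$ where the product ranges over all $j\in\{1,2,\ldots,n\}$ with $j\neq i$, and where $\operatorname{Sym} C$ denotes the symmetric algebra of the $\mathbf{k}$-module $C$.
   Context: All coalgebras, linear maps and tensor products are over $\mathbf{k}$. A $\mathbf{k}$-coalgebra is a $\mathbf{k}$-module $C$ with $\mathbf{k}$-linear maps $\Delta:C\to C\otimes C$ and $\epsilon:C\to\mathbf{k}$ satisfying coassociativity and counitality. An element $g\in C$ is called grouplike if $\Delta(g)=g\otimes g$ and $\epsilon(g)=1$. *)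

theory Defs
  imports "HOL-Algebra.Module" "HOL-Algebra.QuotRing"
begin

section \<open>Linear maps, free modules and quotients\<close>

definition linear_maps ::
    "('r, 'p) ring_scheme \<Rightarrow> ('r, 'a, 'm) module_scheme \<Rightarrow> ('r, 'b, 'n) module_scheme \<Rightarrow> ('a \<Rightarrow> 'b) set"
  where "linear_maps R M N =
    {f \<in> carrier M \<rightarrow> carrier N.
      (\<forall>x\<in>carrier M. \<forall>y\<in>carrier M. f (x \<oplus>\<^bsub>M\<^esub> y) = f x \<oplus>\<^bsub>N\<^esub> f y) \<and>
      (\<forall>a\<in>carrier R. \<forall>x\<in>carrier M. f (a \<odot>\<^bsub>M\<^esub> x) = a \<odot>\<^bsub>N\<^esub> f x)}"

definition regular_module :: "('r, 'p) ring_scheme \<Rightarrow> ('r, 'r) module"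
  where "regular_module R =
    \<lparr>carrier = carrier R, mult = mult R, one = one R, zero = zero R, add = add R, smult = mult R\<rparr>"

definition span :: "('r, 'p) ring_scheme \<Rightarrow> ('r, 'a, 'm) module_scheme \<Rightarrow> 'a set \<Rightarrow> 'a set"
  where "span R M S = \<Inter>{N. submodule N R M \<and> S \<subseteq> N}"

text \<open>The ring fields of a module that is not an algebra carry no meaning and are left undefined.\<close>

definition free_module :: "('r, 'p) ring_scheme \<Rightarrow> 'x set \<Rightarrow> ('r, 'x \<Rightarrow> 'r) module"
  where "free_module R X =
    \<lparr>carrier = {f. (\<forall>x\<in>X. f x \<in> carrier R) \<and> (\<forall>x. x \<notin> X \<longrightarrow> f x = \<zero>\<^bsub>R\<^esub>)
                   \<and> finite {x. f x \<noteq> \<zero>\<^bsub>R\<^esub>}},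
     mult = undefined, one = undefined,
     zero = (\<lambda>_. \<zero>\<^bsub>R\<^esub>), add = (\<lambda>f g x. f x \<oplus>\<^bsub>R\<^esub> g x), smult = (\<lambda>a f x. a \<otimes>\<^bsub>R\<^esub> f x)\<rparr>"

definition free_gen :: "('r, 'p) ring_scheme \<Rightarrow> 'x \<Rightarrow> 'x \<Rightarrow> 'r"
  where "free_gen R x = (\<lambda>y. if y = x then \<one>\<^bsub>R\<^esub> else \<zero>\<^bsub>R\<^esub>)"

text \<open>
  The quotient ring of the library together with the induced scalar multiplication. For a
  submodule \<open>N\<close> of a module this is the quotient module (its multiplication being
  meaningless); for an ideal \<open>N\<close> of an algebra it is the quotient algebra.
\<close>

definition quotient :: "('r, 'a, 'm) module_scheme \<Rightarrow> 'a set \<Rightarrow> ('r, 'a set) module"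
  where "quotient M N =
    \<lparr>carrier = carrier (M Quot N), mult = mult (M Quot N), one = one (M Quot N),
     zero = zero (M Quot N), add = add (M Quot N),
     smult = (\<lambda>a X. \<Union>x\<in>X. N +>\<^bsub>M\<^esub> (a \<odot>\<^bsub>M\<^esub> x))\<rparr>"


section \<open>Tensor products\<close>

definition tensor_relators ::
    "('r, 'p) ring_scheme \<Rightarrow> ('r, 'a, 'm) module_scheme \<Rightarrow> ('r, 'b, 'n) module_scheme
      \<Rightarrow> ('a \<times> 'b \<Rightarrow> 'r) set"
  where "tensor_relators R M N =
    (let F = free_module R (carrier M \<times> carrier N); e = (\<lambda>x y. free_gen R (x, y)) in
      {e (x \<oplus>\<^bsub>M\<^esub> x') y \<ominus>\<^bsub>F\<^esub> (e x y \<oplus>\<^bsub>F\<^esub> e x' y) | x x' y.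
        x \<in> carrier M \<and> x' \<in> carrier M \<and> y \<in> carrier N} \<union>
      {e x (y \<oplus>\<^bsub>N\<^esub> y') \<ominus>\<^bsub>F\<^esub> (e x y \<oplus>\<^bsub>F\<^esub> e x y') | x y y'.
        x \<in> carrier M \<and> y \<in> carrier N \<and> y' \<in> carrier N} \<union>
      {e (a \<odot>\<^bsub>M\<^esub> x) y \<ominus>\<^bsub>F\<^esub> a \<odot>\<^bsub>F\<^esub> e x y | a x y.
        a \<in> carrier R \<and> x \<in> carrier M \<and> y \<in> carrier N} \<union>
      {e x (a \<odot>\<^bsub>N\<^esub> y) \<ominus>\<^bsub>F\<^esub> a \<odot>\<^bsub>F\<^esub> e x y | a x y.
        a \<in> carrier R \<and> x \<in> carrier M \<and> y \<in> carrier N})"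

definition tensor_submodule ::
    "('r, 'p) ring_scheme \<Rightarrow> ('r, 'a, 'm) module_scheme \<Rightarrow> ('r, 'b, 'n) module_scheme
      \<Rightarrow> ('a \<times> 'b \<Rightarrow> 'r) set"
  where "tensor_submodule R M N =
    span R (free_module R (carrier M \<times> carrier N)) (tensor_relators R M N)"

definition tensor_product ::
    "('r, 'p) ring_scheme \<Rightarrow> ('r, 'a, 'm) module_scheme \<Rightarrow> ('r, 'b, 'n) module_scheme
      \<Rightarrow> ('r, ('a \<times> 'b \<Rightarrow> 'r) set) module"
  where "tensor_product R M N =
    quotient (free_module R (carrier M \<times> carrier N)) (tensor_submodule R M N)"

definition pure_tensor ::
    "('r, 'p) ring_scheme \<Rightarrow> ('r, 'a, 'm) module_scheme \<Rightarrow> ('r, 'b, 'n) module_scheme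
      \<Rightarrow> 'a \<Rightarrow> 'b \<Rightarrow> ('a \<times> 'b \<Rightarrow> 'r) set"
  where "pure_tensor R M N x y =
    tensor_submodule R M N +>\<^bsub>free_module R (carrier M \<times> carrier N)\<^esub> free_gen R (x, y)"

text \<open>
  The linear map out of a tensor product that is induced by a bilinear map \<open>\<beta>\<close>. The
  restriction to extensional functions makes it unique as a HOL function.
\<close>

definition tensor_lift ::
    "('r, 'p) ring_scheme \<Rightarrow> ('r, 'a, 'm) module_scheme \<Rightarrow> ('r, 'b, 'n) module_scheme
      \<Rightarrow> ('r, 'c, 'k) module_scheme \<Rightarrow> ('a \<Rightarrow> 'b \<Rightarrow> 'c) \<Rightarrow> ('a \<times> 'b \<Rightarrow> 'r) set \<Rightarrow> 'c"
  where "tensor_lift R M N P \<beta> =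
    (THE h. h \<in> linear_maps R (tensor_product R M N) P \<and>
            h \<in> extensional (carrier (tensor_product R M N)) \<and>
            (\<forall>x\<in>carrier M. \<forall>y\<in>carrier N. h (pure_tensor R M N x y) = \<beta> x y))"

definition tensor_map ::
    "('r, 'p) ring_scheme \<Rightarrow> ('r, 'a, 'm) module_scheme \<Rightarrow> ('r, 'b, 'n) module_scheme
      \<Rightarrow> ('r, 'c, 'k) module_scheme \<Rightarrow> ('r, 'd, 'l) module_scheme
      \<Rightarrow> ('a \<Rightarrow> 'c) \<Rightarrow> ('b \<Rightarrow> 'd) \<Rightarrow> ('a \<times> 'b \<Rightarrow> 'r) set \<Rightarrow> ('c \<times> 'd \<Rightarrow> 'r) set"
  where "tensor_map R M N M' N' f g =
    tensor_lift R M N (tensor_product R M' N') (\<lambda>x y. pure_tensor R M' N' (f x) (g y))"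

definition tensor_assoc ::
    "('r, 'p) ring_scheme \<Rightarrow> ('r, 'a, 'm) module_scheme \<Rightarrow> ('r, 'b, 'n) module_scheme
      \<Rightarrow> ('r, 'c, 'k) module_scheme
      \<Rightarrow> (('a \<times> 'b \<Rightarrow> 'r) set \<times> 'c \<Rightarrow> 'r) set \<Rightarrow> ('a \<times> ('b \<times> 'c \<Rightarrow> 'r) set \<Rightarrow> 'r) set"
  where "tensor_assoc R M N P =
    (let NP = tensor_product R N P; T = tensor_product R M NP in
      tensor_lift R (tensor_product R M N) P T
        (\<lambda>t z. tensor_lift R M N T (\<lambda>x y. pure_tensor R M NP x (pure_tensor R N P y z)) t))"


section \<open>Coalgebras\<close>

locale coalgebra = module R C for R (structure) and C (structure) +
  fixes \<Delta> :: "'b \<Rightarrow> ('b \<times> 'b \<Rightarrow> 'a) set" and \<epsilon> :: "'b \<Rightarrow> 'a"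
  assumes comult_linear: "\<Delta> \<in> linear_maps R C (tensor_product R C C)"
    and counit_linear: "\<epsilon> \<in> linear_maps R C (regular_module R)"
    and coassoc: "x \<in> carrier C \<Longrightarrow>
      tensor_assoc R C C C (tensor_map R C C (tensor_product R C C) C \<Delta> id (\<Delta> x))
        = tensor_map R C C C (tensor_product R C C) id \<Delta> (\<Delta> x)"
    and counit_left: "x \<in> carrier C \<Longrightarrow>
      tensor_map R C C (regular_module R) C \<epsilon> id (\<Delta> x) = pure_tensor R (regular_module R) C \<one> x"
    and counit_right: "x \<in> carrier C \<Longrightarrow>
      tensor_map R C C C (regular_module R) id \<epsilon> (\<Delta> x) = pure_tensor R C (regular_module R) x \<one>"

definition grouplike ::
    "('r, 'p) ring_scheme \<Rightarrow> ('r, 'a, 'm) module_scheme \<Rightarrow> ('a \<Rightarrow> ('a \<times> 'a \<Rightarrow> 'r) set)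
      \<Rightarrow> ('a \<Rightarrow> 'r) \<Rightarrow> 'a \<Rightarrow> bool"
  where "grouplike R C \<Delta> \<epsilon> g \<longleftrightarrow>
    g \<in> carrier C \<and> \<Delta> g = pure_tensor R C C g g \<and> \<epsilon> g = \<one>\<^bsub>R\<^esub>"


section \<open>The symmetric algebra\<close>

text \<open>
  The tensor algebra \<open>T(M) = \<Oplus>\<^sub>n M\<^sup>\<otimes>\<^sup>n\<close>. A word of length \<open>n\<close> over \<open>M\<close> stands for a pure
  tensor in \<open>M\<^sup>\<otimes>\<^sup>n\<close>, so that \<open>T(M)\<close> is spanned by all words subject to linearity in every
  letter, with concatenation as multiplication. The ideal generated by the linearity relations
  between one-letter words consists of exactly these relations, since multiplying by words on
  both sides puts them at an arbitrary position.
\<close>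

definition free_algebra :: "('r, 'p) ring_scheme \<Rightarrow> 'x set \<Rightarrow> ('r, 'x list \<Rightarrow> 'r) module"
  where "free_algebra R X = (free_module R (lists X))
    \<lparr>mult := (\<lambda>f g w. \<Oplus>\<^bsub>R\<^esub>k\<in>{..length w}. f (take k w) \<otimes>\<^bsub>R\<^esub> g (drop k w)),
     one := free_gen R []\<rparr>"

definition tensor_algebra_ideal ::
    "('r, 'p) ring_scheme \<Rightarrow> ('r, 'a, 'm) module_scheme \<Rightarrow> ('a list \<Rightarrow> 'r) set"
  where "tensor_algebra_ideal R M =
    (let F = free_algebra R (carrier M); e = (\<lambda>x. free_gen R [x]) in
      genideal F
       ({e (x \<oplus>\<^bsub>M\<^esub> y) \<ominus>\<^bsub>F\<^esub> (e x \<oplus>\<^bsub>F\<^esub> e y) | x y. x \<in> carrier M \<and> y \<in> carrier M} \<union>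
        {e (a \<odot>\<^bsub>M\<^esub> x) \<ominus>\<^bsub>F\<^esub> a \<odot>\<^bsub>F\<^esub> e x | a x. a \<in> carrier R \<and> x \<in> carrier M}))"

definition tensor_algebra ::
    "('r, 'p) ring_scheme \<Rightarrow> ('r, 'a, 'm) module_scheme \<Rightarrow> ('r, ('a list \<Rightarrow> 'r) set) module"
  where "tensor_algebra R M = quotient (free_algebra R (carrier M)) (tensor_algebra_ideal R M)"

definition tensor_algebra_incl ::
    "('r, 'p) ring_scheme \<Rightarrow> ('r, 'a, 'm) module_scheme \<Rightarrow> 'a \<Rightarrow> ('a list \<Rightarrow> 'r) set"
  where "tensor_algebra_incl R M x =
    tensor_algebra_ideal R M +>\<^bsub>free_algebra R (carrier M)\<^esub> free_gen R [x]"

definition sym_ideal ::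
    "('r, 'p) ring_scheme \<Rightarrow> ('r, 'a, 'm) module_scheme \<Rightarrow> ('a list \<Rightarrow> 'r) set set"
  where "sym_ideal R M =
    (let T = tensor_algebra R M; j = tensor_algebra_incl R M in
      genideal T {j x \<otimes>\<^bsub>T\<^esub> j y \<ominus>\<^bsub>T\<^esub> j y \<otimes>\<^bsub>T\<^esub> j x | x y. x \<in> carrier M \<and> y \<in> carrier M})"

definition sym_algebra ::
    "('r, 'p) ring_scheme \<Rightarrow> ('r, 'a, 'm) module_scheme \<Rightarrow> ('r, ('a list \<Rightarrow> 'r) set set) module"
  where "sym_algebra R M = quotient (tensor_algebra R M) (sym_ideal R M)"

definition sym_incl ::
    "('r, 'p) ring_scheme \<Rightarrow> ('r, 'a, 'm) module_scheme \<Rightarrow> 'a \<Rightarrow> ('a list \<Rightarrow> 'r) set set"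
  where "sym_incl R M x = sym_ideal R M +>\<^bsub>tensor_algebra R M\<^esub> tensor_algebra_incl R M x"

end

theory Submission
  imports Defs
begin

text \<open>
  Over a field, distinct grouplike elements are linearly independent. The theorem is the version
  over a commutative ring, and the proof is Lagrange interpolation. If the linear relation
  \<open>\<Sum> c\<^sub>l g\<^sub>l = 0\<close> implied \<open>\<Sum> c\<^sub>l P(g\<^sub>l) = 0\<close> in \<open>Sym C\<close> for polynomials \<open>P\<close> with coefficients in
  \<open>Sym C\<close>, then the choice \<open>P = \<Prod>\<^sub>j (t - g\<^sub>j)\<close>, \<open>j \<noteq> i\<close>, would finish the proof, because \<open>P\<close> vanishes
  at every \<open>g\<^sub>l\<close> with \<open>l \<noteq> i\<close>.

  The implication holds because on grouplike elements such a \<open>P\<close> is the restriction of a linear map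
  \<open>C \<rightarrow> Sym C\<close>. The linear maps from a coalgebra to a commutative algebra form an algebra under
  convolution, \<open>f * h = \<mu> \<circ> (f \<otimes> h) \<circ> \<Delta>\<close>, and \<open>\<Delta> x = x \<otimes> x\<close> makes convolution the pointwise product
  at grouplike \<open>x\<close> (lemma \<open>convolution\<close>). A constant \<open>a\<close> is represented by the linear map
  \<open>x \<mapsto> \<epsilon>(x) a\<close>. So each factor \<open>t - g\<^sub>j\<close> is represented by a linear map, and hence so is their product
  (lemma \<open>product_of_differences_linear\<close>). This works in any commutative algebra that receives a
  linear map from \<open>C\<close> (lemma \<open>grouplike_relation\<close>).

  The rest establishes what this argument takes for granted about the explicit constructions:
  bilinear maps factor through the tensor product (lemma \<open>tensor_product_lift\<close>), and \<open>Sym C\<close> is a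
  commutative algebra with a linear map from \<open>C\<close> (lemmas \<open>sym_algebra_algebra\<close> and
  \<open>sym_incl_linear\<close>). For the latter, the words over \<open>C\<close> are shown to span an associative algebra, and
  commutativity of its quotient is deduced from commutativity of the letters, which generate it.
\<close>


section \<open>Linear maps and quotient modules\<close>

lemma linear_mapsI:
  assumes "\<And>x. x \<in> carrier M \<Longrightarrow> f x \<in> carrier N"
    and "\<And>x y. x \<in> carrier M \<Longrightarrow> y \<in> carrier M \<Longrightarrow> f (x \<oplus>\<^bsub>M\<^esub> y) = f x \<oplus>\<^bsub>N\<^esub> f y"
    and "\<And>a x. a \<in> carrier R \<Longrightarrow> x \<in> carrier M \<Longrightarrow> f (a \<odot>\<^bsub>M\<^esub> x) = a \<odot>\<^bsub>N\<^esub> f x"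
  shows "f \<in> linear_maps R M N"
  using assms by (auto simp: linear_maps_def)

lemma linear_mapsD:
  assumes "f \<in> linear_maps R M N"
  shows linear_map_closed: "x \<in> carrier M \<Longrightarrow> f x \<in> carrier N"
    and linear_map_add: "x \<in> carrier M \<Longrightarrow> y \<in> carrier M \<Longrightarrow> f (x \<oplus>\<^bsub>M\<^esub> y) = f x \<oplus>\<^bsub>N\<^esub> f y"
    and linear_map_smult: "a \<in> carrier R \<Longrightarrow> x \<in> carrier M \<Longrightarrow> f (a \<odot>\<^bsub>M\<^esub> x) = a \<odot>\<^bsub>N\<^esub> f x"
  using assms by (auto simp: linear_maps_def)

lemma linear_map_comp:
  assumes "f \<in> linear_maps R M N" "h \<in> linear_maps R N P"
  shows "(\<lambda>x. h (f x)) \<in> linear_maps R M P"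
  using assms by (intro linear_mapsI) (simp_all add: linear_mapsD)

lemma linear_map_zero:
  assumes "module R M" "module R N" "f \<in> linear_maps R M N"
  shows "f \<zero>\<^bsub>M\<^esub> = \<zero>\<^bsub>N\<^esub>"
proof -
  interpret M: module R M by fact
  interpret N: module R N by fact
  have "f (\<zero>\<^bsub>R\<^esub> \<odot>\<^bsub>M\<^esub> \<zero>\<^bsub>M\<^esub>) = \<zero>\<^bsub>R\<^esub> \<odot>\<^bsub>N\<^esub> f \<zero>\<^bsub>M\<^esub>"
    by (intro linear_map_smult[OF assms(3)]) auto
  then show ?thesis
    using assms(3) by (simp add: linear_map_closed)
qed

lemma linear_map_minus:
  assumes "module R M" "module R N" "f \<in> linear_maps R M N"
    and "x \<in> carrier M" "y \<in> carrier M"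
  shows "f (x \<ominus>\<^bsub>M\<^esub> y) = f x \<ominus>\<^bsub>N\<^esub> f y"
proof -
  interpret M: module R M by fact
  interpret N: module R N by fact
  have "f (\<ominus>\<^bsub>M\<^esub> y) = \<ominus>\<^bsub>N\<^esub> f y"
    using linear_map_smult[OF assms(3), of "\<ominus>\<^bsub>R\<^esub> \<one>\<^bsub>R\<^esub>" y] assms(3,5)
    by (simp add: M.smult_l_minus N.smult_l_minus linear_map_closed)
  then show ?thesis
    using assms(3-5) by (simp add: a_minus_def linear_map_add)
qed

lemma linear_map_finsum:
  assumes "module R M" "module R N" "f \<in> linear_maps R M N"
    and "finite S" "\<And>i. i \<in> S \<Longrightarrow> x i \<in> carrier M"
  shows "f (\<Oplus>\<^bsub>M\<^esub>i\<in>S. x i) = (\<Oplus>\<^bsub>N\<^esub>i\<in>S. f (x i))"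
proof -
  interpret M: module R M by fact
  interpret N: module R N by fact
  show ?thesis
    using assms(4,5)
  proof (induction S)
    case empty
    show ?case
      using linear_map_zero[OF assms(1-3)] by simp
  next
    case (insert i S)
    then have "x \<in> S \<rightarrow> carrier M" "(\<lambda>i. f (x i)) \<in> S \<rightarrow> carrier N"
      using linear_map_closed[OF assms(3)] by auto
    with insert show ?case
      using assms(3) by (simp add: linear_map_add linear_map_closed)
  qed
qed

lemma kernel_submodule:
  assumes "module R M" "module R N" "f \<in> linear_maps R M N"
  shows "submodule {x \<in> carrier M. f x = \<zero>\<^bsub>N\<^esub>} R M"
proof -
  interpret M: module R M by fact
  interpret N: module R N by fact
  have "f (\<ominus>\<^bsub>M\<^esub> y) = \<zero>\<^bsub>N\<^esub>" if "y \<in> carrier M" "f y = \<zero>\<^bsub>N\<^esub>" for y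
    using linear_map_minus[OF assms M.zero_closed that(1)] that linear_map_zero[OF assms]
    by (simp add: M.minus_eq N.minus_eq)
  then show ?thesis
    using linear_map_zero[OF assms] assms(3)
    by (intro M.submoduleI) (auto simp: linear_map_add linear_map_smult)
qed

lemma quotient_simps:
  "add (quotient M N) = set_add M" "mult (quotient M N) = rcoset_mult M N"
  "zero (quotient M N) = N" "one (quotient M N) = N +>\<^bsub>M\<^esub> \<one>\<^bsub>M\<^esub>"
  by (simp_all add: quotient_def FactRing_def)

lemma carrier_quotient: "carrier (quotient M N) = (\<lambda>x. N +>\<^bsub>M\<^esub> x) ` carrier M"
  by (auto simp: quotient_def FactRing_simps)

context module
begin

lemma submodule_abelian_subgroup:
  assumes "submodule N R M"
  shows "abelian_subgroup N M"
  using assms by (intro abelian_subgroupI3 additive_subgroupI)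
    (auto simp: submodule_def M.abelian_group_axioms)

context
  fixes N assumes N: "submodule N R M"
begin

interpretation N: abelian_subgroup N M
  by (rule submodule_abelian_subgroup[OF N])

lemma quotient_add:
  assumes "x \<in> carrier M" "y \<in> carrier M"
  shows "(N +>\<^bsub>M\<^esub> x) \<oplus>\<^bsub>quotient M N\<^esub> (N +>\<^bsub>M\<^esub> y) = N +>\<^bsub>M\<^esub> (x \<oplus>\<^bsub>M\<^esub> y)"
  using assms by (simp add: quotient_simps N.a_rcos_sum)

lemma quotient_smult:
  assumes "a \<in> carrier R" "x \<in> carrier M"
  shows "a \<odot>\<^bsub>quotient M N\<^esub> (N +>\<^bsub>M\<^esub> x) = N +>\<^bsub>M\<^esub> (a \<odot>\<^bsub>M\<^esub> x)"
proof -
  have "N +>\<^bsub>M\<^esub> (a \<odot>\<^bsub>M\<^esub> y) = N +>\<^bsub>M\<^esub> (a \<odot>\<^bsub>M\<^esub> x)" if y: "y \<in> N +>\<^bsub>M\<^esub> x" for y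
  proof -
    obtain k where k: "k \<in> N" "y = k \<oplus>\<^bsub>M\<^esub> x"
      using y by (auto simp: a_r_coset_def')
    then have "a \<odot>\<^bsub>M\<^esub> y = a \<odot>\<^bsub>M\<^esub> k \<oplus>\<^bsub>M\<^esub> a \<odot>\<^bsub>M\<^esub> x"
      using assms by (simp add: smult_r_distr)
    moreover have "a \<odot>\<^bsub>M\<^esub> k \<in> N"
      using N k(1) assms(1) by (simp add: submodule.smult_closed)
    ultimately have "a \<odot>\<^bsub>M\<^esub> y \<in> N +>\<^bsub>M\<^esub> (a \<odot>\<^bsub>M\<^esub> x)"
      by (auto simp: a_r_coset_def')
    then show ?thesis
      using assms by (intro N.a_repr_independence'[symmetric]) auto
  qed
  then have "(\<Union>y\<in>N +>\<^bsub>M\<^esub> x. N +>\<^bsub>M\<^esub> (a \<odot>\<^bsub>M\<^esub> y)) = (\<Union>y\<in>N +>\<^bsub>M\<^esub> x. N +>\<^bsub>M\<^esub> (a \<odot>\<^bsub>M\<^esub> x))"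
    by (intro SUP_cong refl)
  also have "\<dots> = N +>\<^bsub>M\<^esub> (a \<odot>\<^bsub>M\<^esub> x)"
    using N.a_rcos_self[OF assms(2)] by auto
  finally show ?thesis
    by (simp add: quotient_def)
qed

lemma coset_linear: "(\<lambda>x. N +>\<^bsub>M\<^esub> x) \<in> linear_maps R M (quotient M N)"
  by (intro linear_mapsI) (auto simp: carrier_quotient quotient_add quotient_smult)

lemma coset_eq_zero_iff:
  assumes "x \<in> carrier M"
  shows "N +>\<^bsub>M\<^esub> x = \<zero>\<^bsub>quotient M N\<^esub> \<longleftrightarrow> x \<in> N"
  using N.a_rcos_const N.a_rcos_self[OF assms] by (auto simp: quotient_simps)

lemma quotient_module: "module R (quotient M N)"
proof -
  have zero: "\<zero>\<^bsub>quotient M N\<^esub> = N +>\<^bsub>M\<^esub> \<zero>\<^bsub>M\<^esub>"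
    using coset_eq_zero_iff[of "\<zero>\<^bsub>M\<^esub>"] by simp
  have neg: "\<exists>Y\<in>carrier (quotient M N). Y \<oplus>\<^bsub>quotient M N\<^esub> (N +>\<^bsub>M\<^esub> x) = \<zero>\<^bsub>quotient M N\<^esub>"
    if "x \<in> carrier M" for x
    using that by (intro bexI[of _ "N +>\<^bsub>M\<^esub> (\<ominus>\<^bsub>M\<^esub> x)"])
      (simp_all add: quotient_add zero M.l_neg carrier_quotient)
  have "abelian_group (quotient M N)"
  proof (rule abelian_groupI)
    show "\<exists>Y\<in>carrier (quotient M N). Y \<oplus>\<^bsub>quotient M N\<^esub> X = \<zero>\<^bsub>quotient M N\<^esub>"
      if "X \<in> carrier (quotient M N)" for X
      using that neg by (auto simp: carrier_quotient)
  qed (auto simp: carrier_quotient quotient_add M.a_ac zero)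
  then show ?thesis
    by (intro moduleI) (auto simp: carrier_quotient quotient_add quotient_smult R.cring_axioms
        smult_l_distr smult_r_distr smult_assoc1)
qed

text \<open>
  A linear map that vanishes on \<open>N\<close> is constant on each coset, so the coset determines its value.
\<close>

lemma quotient_lift:
  assumes "module R P" "f \<in> linear_maps R M P" "\<And>x. x \<in> N \<Longrightarrow> f x = \<zero>\<^bsub>P\<^esub>"
  obtains h where "h \<in> linear_maps R (quotient M N) P"
    and "\<And>x. x \<in> carrier M \<Longrightarrow> h (N +>\<^bsub>M\<^esub> x) = f x"
proof -
  interpret P: module R P by fact
  define h where "h = (\<lambda>X. the_elem (f ` X))"
  have "f ` (N +>\<^bsub>M\<^esub> x) = {f x}" if "x \<in> carrier M" for x
  proof -
    have "f y = f x" if "y \<in> N +>\<^bsub>M\<^esub> x" for y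
      using that \<open>x \<in> carrier M\<close> assms(2,3)
      by (auto simp: a_r_coset_def' linear_map_add linear_map_closed)
    moreover have "x \<in> N +>\<^bsub>M\<^esub> x"
      using that by (rule N.a_rcos_self)
    ultimately show ?thesis by blast
  qed
  then have h: "h (N +>\<^bsub>M\<^esub> x) = f x" if "x \<in> carrier M" for x
    using that by (simp add: h_def)
  moreover have "h \<in> linear_maps R (quotient M N) P"
    using assms(2) by (intro linear_mapsI)
      (auto simp: carrier_quotient quotient_add quotient_smult h linear_mapsD)
  ultimately show thesis
    using that by blast
qed

end

end


lemma (in module) coset_eqI:
  assumes "submodule N R M" "x \<in> carrier M" "y \<in> carrier M" "x \<ominus>\<^bsub>M\<^esub> y \<in> N"
  shows "N +>\<^bsub>M\<^esub> x = N +>\<^bsub>M\<^esub> y"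
proof -
  interpret N: abelian_subgroup N M
    by (rule submodule_abelian_subgroup[OF assms(1)])
  have "x \<in> N +>\<^bsub>M\<^esub> y"
    using assms(2-4) N.a_rcos_module_minus[of y x] M.abelian_group_axioms
    by (simp add: N.a_rcos_module M.minus_eq)
  then show ?thesis
    using assms(3) by (intro N.a_repr_independence'[symmetric])
qed


section \<open>Free modules\<close>

lemma free_module_simps:
  "add (free_module R X) = (\<lambda>f g x. f x \<oplus>\<^bsub>R\<^esub> g x)" "zero (free_module R X) = (\<lambda>_. \<zero>\<^bsub>R\<^esub>)"
  "smult (free_module R X) = (\<lambda>a f x. a \<otimes>\<^bsub>R\<^esub> f x)"
  by (simp_all add: free_module_def)

lemma free_moduleD:
  assumes "f \<in> carrier (free_module R X)"
  shows "x \<in> X \<Longrightarrow> f x \<in> carrier R" "x \<notin> X \<Longrightarrow> f x = \<zero>\<^bsub>R\<^esub>" "finite {x. f x \<noteq> \<zero>\<^bsub>R\<^esub>}"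
  using assms by (auto simp: free_module_def)

context cring
begin

lemma free_module_closed:
  assumes "f \<in> carrier (free_module R X)"
  shows "f x \<in> carrier R"
  using assms by (cases "x \<in> X") (auto simp: free_module_def)

lemma free_moduleI:
  assumes "\<And>x. f x \<in> carrier R" "\<And>x. x \<notin> X \<Longrightarrow> f x = \<zero>" "{x. f x \<noteq> \<zero>} \<subseteq> S" "finite S"
  shows "f \<in> carrier (free_module R X)"
  using assms finite_subset by (auto simp: free_module_def)

lemma free_gen_closed: "x \<in> X \<Longrightarrow> free_gen R x \<in> carrier (free_module R X)"
  by (rule free_moduleI[where S = "{x}"]) (auto simp: free_gen_def)

lemma free_module_module: "module R (free_module R X)"
proof -
  let ?F = "free_module R X"
  have add: "f \<oplus>\<^bsub>?F\<^esub> g \<in> carrier ?F" if fg: "f \<in> carrier ?F" "g \<in> carrier ?F" for f g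
    using free_moduleD(2,3)[OF fg(1)] free_moduleD(2,3)[OF fg(2)]
      free_module_closed[OF fg(1)] free_module_closed[OF fg(2)]
    by (intro free_moduleI[where S = "{x. f x \<noteq> \<zero>} \<union> {x. g x \<noteq> \<zero>}"])
      (auto simp: free_module_simps)
  have smult: "a \<odot>\<^bsub>?F\<^esub> f \<in> carrier ?F" if f: "f \<in> carrier ?F" "a \<in> carrier R" for a f
    using f(2) free_moduleD(2,3)[OF f(1)] free_module_closed[OF f(1)]
    by (intro free_moduleI[where S = "{x. f x \<noteq> \<zero>}"]) (auto simp: free_module_simps)
  have zero: "\<zero>\<^bsub>?F\<^esub> \<in> carrier ?F"
    by (intro free_moduleI[where S = "{}"]) (auto simp: free_module_simps)
  have "abelian_group ?F"
  proof (rule abelian_groupI)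
    fix f assume f: "f \<in> carrier ?F"
    note closed = free_module_closed[OF f]
    show "\<exists>g\<in>carrier ?F. g \<oplus>\<^bsub>?F\<^esub> f = \<zero>\<^bsub>?F\<^esub>"
      using smult[OF f, of "\<ominus> \<one>"] closed
      by (intro bexI[of _ "(\<ominus> \<one>) \<odot>\<^bsub>?F\<^esub> f"]) (auto simp: free_module_simps l_minus l_neg)
    show "\<zero>\<^bsub>?F\<^esub> \<oplus>\<^bsub>?F\<^esub> f = f"
      using closed by (simp add: free_module_simps)
    fix g assume g: "g \<in> carrier ?F"
    note closed = closed free_module_closed[OF g]
    show "f \<oplus>\<^bsub>?F\<^esub> g = g \<oplus>\<^bsub>?F\<^esub> f"
      using closed by (simp add: free_module_simps a_comm)
    fix h assume h: "h \<in> carrier ?F"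
    show "f \<oplus>\<^bsub>?F\<^esub> g \<oplus>\<^bsub>?F\<^esub> h = f \<oplus>\<^bsub>?F\<^esub> (g \<oplus>\<^bsub>?F\<^esub> h)"
      using closed free_module_closed[OF h] by (simp add: free_module_simps a_assoc)
  qed (fact add zero)+
  then show ?thesis
  proof (intro moduleI)
    fix f assume f: "f \<in> carrier ?F"
    note closed = free_module_closed[OF f]
    show "\<one> \<odot>\<^bsub>?F\<^esub> f = f"
      using closed by (simp add: free_module_simps)
    fix a assume a: "a \<in> carrier R"
    show "a \<odot>\<^bsub>?F\<^esub> (f \<oplus>\<^bsub>?F\<^esub> g) = a \<odot>\<^bsub>?F\<^esub> f \<oplus>\<^bsub>?F\<^esub> a \<odot>\<^bsub>?F\<^esub> g" if "g \<in> carrier ?F" for g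
      using a closed free_module_closed[OF that] by (simp add: free_module_simps r_distr)
    fix b assume b: "b \<in> carrier R"
    show "(a \<oplus> b) \<odot>\<^bsub>?F\<^esub> f = a \<odot>\<^bsub>?F\<^esub> f \<oplus>\<^bsub>?F\<^esub> b \<odot>\<^bsub>?F\<^esub> f"
      using a b closed by (simp add: free_module_simps l_distr)
    show "(a \<otimes> b) \<odot>\<^bsub>?F\<^esub> f = a \<odot>\<^bsub>?F\<^esub> (b \<odot>\<^bsub>?F\<^esub> f)"
      using a b closed by (simp add: free_module_simps m_assoc)
  qed (auto intro: cring_axioms smult)
qed

text \<open>
  A finitely supported function is reached by adding up its values one point of the support at
  a time. This is the spanning half of being a basis and gives induction on basis elements.
\<close>

lemma free_module_generated:
  assumes "submodule U R (free_module R X)" "\<And>x. x \<in> X \<Longrightarrow> free_gen R x \<in> U"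
  shows "U = carrier (free_module R X)"
proof -
  let ?F = "free_module R X"
  interpret F: module R ?F by (rule free_module_module)
  have "f \<in> U" if "finite S" "f \<in> carrier ?F" "{x. f x \<noteq> \<zero>} \<subseteq> S" for S f
    using that
  proof (induction S arbitrary: f)
    case empty
    then have "f = \<zero>\<^bsub>?F\<^esub>"
      by (auto simp: free_module_simps)
    moreover obtain u where "u \<in> U"
      using F.submoduleE(2)[OF assms(1)] by blast
    ultimately show ?case
      using F.submoduleE(1,4)[OF assms(1)] F.smult_l_null[of u]
      by (metis subsetD zero_closed)
  next
    case (insert x S)
    note closed = free_module_closed[OF insert.prems(1)]
    have f': "f(x := \<zero>) \<in> carrier ?F"
      using free_moduleD(2,3)[OF insert.prems(1)] closed
      by (intro free_moduleI[where S = "{x. f x \<noteq> \<zero>}"]) auto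
    then have U': "f(x := \<zero>) \<in> U"
      using insert.prems(2) by (intro insert.IH[OF f']) auto
    show ?case
    proof (cases "x \<in> X")
      case True
      have "f = (f x \<odot>\<^bsub>?F\<^esub> free_gen R x) \<oplus>\<^bsub>?F\<^esub> f(x := \<zero>)"
        using closed by (auto simp: free_module_simps free_gen_def)
      moreover have "f x \<odot>\<^bsub>?F\<^esub> free_gen R x \<in> U"
        using F.submoduleE(4)[OF assms(1)] assms(2) True closed
        by simp
      ultimately show ?thesis
        using F.submoduleE(5)[OF assms(1)] U' by metis
    next
      case False
      then have "f(x := \<zero>) = f"
        using free_moduleD(2)[OF insert.prems(1)] by auto
      with U' show ?thesis by simp
    qed
  qed
  then show ?thesis
    using F.submoduleE(1)[OF assms(1)] free_moduleD(3)[of _ R X] by blast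
qed

text \<open>
  The lift is \<open>f \<mapsto> \<Sum> f x \<odot> \<phi> x\<close> over the support of \<open>f\<close>. Supports do not behave well under
  addition (cancellation makes them shrink), so linearity is checked on larger finite sets, where
  the extra summands are zero.
\<close>

lemma free_module_lift:
  assumes "module R P" "\<And>x. x \<in> X \<Longrightarrow> \<phi> x \<in> carrier P"
  obtains h where "h \<in> linear_maps R (free_module R X) P"
    and "\<And>x. x \<in> X \<Longrightarrow> h (free_gen R x) = \<phi> x"
proof -
  let ?F = "free_module R X"
  interpret F: module R ?F by (rule free_module_module)
  interpret P: module R P by fact
  define h where "h = (\<lambda>f. \<Oplus>\<^bsub>P\<^esub>x\<in>{x. f x \<noteq> \<zero>}. f x \<odot>\<^bsub>P\<^esub> \<phi> x)"
  have h: "h f = (\<Oplus>\<^bsub>P\<^esub>x\<in>S. f x \<odot>\<^bsub>P\<^esub> \<phi> x)"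
    if "f \<in> carrier ?F" "finite S" "{x. f x \<noteq> \<zero>} \<subseteq> S" "S \<subseteq> X" for f S
    unfolding h_def using that(2-4) free_module_closed[OF that(1)] assms(2)
    by (intro P.add.finprod_mono_neutral_cong_left) auto
  have supp: "finite {x. f x \<noteq> \<zero>}" "{x. f x \<noteq> \<zero>} \<subseteq> X" if "f \<in> carrier ?F" for f
    using free_moduleD[OF that] by auto
  have "h \<in> linear_maps R ?F P"
  proof (rule linear_mapsI)
    fix f assume f: "f \<in> carrier ?F"
    note closed = free_module_closed[OF f]
    show "h f \<in> carrier P"
      using closed supp[OF f] assms(2) unfolding h_def by (intro P.finsum_closed) auto
    fix a assume a: "a \<in> carrier R"
    have "h (a \<odot>\<^bsub>?F\<^esub> f) = (\<Oplus>\<^bsub>P\<^esub>x\<in>{x. f x \<noteq> \<zero>}. (a \<odot>\<^bsub>?F\<^esub> f) x \<odot>\<^bsub>P\<^esub> \<phi> x)"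
      using a supp[OF f] closed F.smult_closed[OF a f] by (intro h) (auto simp: free_module_simps)
    also have "\<dots> = (\<Oplus>\<^bsub>P\<^esub>x\<in>{x. f x \<noteq> \<zero>}. a \<odot>\<^bsub>P\<^esub> (f x \<odot>\<^bsub>P\<^esub> \<phi> x))"
      using a closed supp[OF f] assms(2)
      by (intro P.finsum_cong') (auto simp: free_module_simps P.smult_assoc1 subset_iff)
    also have "\<dots> = a \<odot>\<^bsub>P\<^esub> h f"
      unfolding h_def using a closed supp[OF f] assms(2)
      by (intro P.finsum_smult_ldistr[symmetric]) auto
    finally show "h (a \<odot>\<^bsub>?F\<^esub> f) = a \<odot>\<^bsub>P\<^esub> h f" .
  next
    fix f g assume fg: "f \<in> carrier ?F" "g \<in> carrier ?F"
    note closed = free_module_closed[OF fg(1)] free_module_closed[OF fg(2)]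
    define S where "S = {x. f x \<noteq> \<zero>} \<union> {x. g x \<noteq> \<zero>}"
    have S: "finite S" "S \<subseteq> X"
      using supp fg by (auto simp: S_def)
    have "h (f \<oplus>\<^bsub>?F\<^esub> g) = (\<Oplus>\<^bsub>P\<^esub>x\<in>S. (f \<oplus>\<^bsub>?F\<^esub> g) x \<odot>\<^bsub>P\<^esub> \<phi> x)"
      using S F.a_closed[OF fg] by (intro h) (auto simp: S_def free_module_simps)
    also have "\<dots> = (\<Oplus>\<^bsub>P\<^esub>x\<in>S. f x \<odot>\<^bsub>P\<^esub> \<phi> x \<oplus>\<^bsub>P\<^esub> g x \<odot>\<^bsub>P\<^esub> \<phi> x)"
      using S closed assms(2)
      by (intro P.finsum_cong') (auto simp: free_module_simps P.smult_l_distr subset_iff)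
    also have "\<dots> = (\<Oplus>\<^bsub>P\<^esub>x\<in>S. f x \<odot>\<^bsub>P\<^esub> \<phi> x) \<oplus>\<^bsub>P\<^esub> (\<Oplus>\<^bsub>P\<^esub>x\<in>S. g x \<odot>\<^bsub>P\<^esub> \<phi> x)"
      using S closed assms(2) by (intro P.finsum_addf) auto
    also have "\<dots> = h f \<oplus>\<^bsub>P\<^esub> h g"
      using S fg by (simp add: h[of _ S] S_def)
    finally show "h (f \<oplus>\<^bsub>?F\<^esub> g) = h f \<oplus>\<^bsub>P\<^esub> h g" .
  qed
  moreover have "h (free_gen R x) = \<phi> x" if "x \<in> X" for x
  proof -
    have "h (free_gen R x) = (\<Oplus>\<^bsub>P\<^esub>y\<in>{x}. free_gen R x y \<odot>\<^bsub>P\<^esub> \<phi> y)"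
      using that by (intro h) (auto simp: free_gen_closed, simp add: free_gen_def split: if_splits)
    also have "\<dots> = \<phi> x"
      using that assms(2) by (simp add: free_gen_def)
    finally show ?thesis .
  qed
  ultimately show thesis
    using that by blast
qed

end


section \<open>Bilinear maps and the tensor product\<close>

lemma span_minimal:
  assumes "submodule N R M" "S \<subseteq> N"
  shows "span R M S \<subseteq> N"
  using assms by (auto simp: span_def)

lemma (in module) span_submodule:
  assumes "S \<subseteq> carrier M"
  shows "submodule (span R M S) R M"
proof (rule submoduleI)
  show "span R M S \<subseteq> carrier M"
    by (rule span_minimal[OF carrier_is_submodule assms])
  have "\<zero>\<^bsub>M\<^esub> \<in> N" if "submodule N R M" for N
    using additive_subgroup.zero_closed abelian_subgroup.axioms(1) submodule_abelian_subgroup[OF that]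
    by blast
  then show "\<zero>\<^bsub>M\<^esub> \<in> span R M S"
    by (auto simp: span_def)
qed (auto simp: span_def dest: submoduleE)

lemma tensor_relators_cases:
  fixes R (structure)
  assumes "r \<in> tensor_relators R M N"
  defines "F \<equiv> free_module R (carrier M \<times> carrier N)"
  obtains
    (add_left) x x' y where "x \<in> carrier M" "x' \<in> carrier M" "y \<in> carrier N"
      "r = free_gen R (x \<oplus>\<^bsub>M\<^esub> x', y) \<ominus>\<^bsub>F\<^esub> (free_gen R (x, y) \<oplus>\<^bsub>F\<^esub> free_gen R (x', y))"
  | (add_right) x y y' where "x \<in> carrier M" "y \<in> carrier N" "y' \<in> carrier N"
      "r = free_gen R (x, y \<oplus>\<^bsub>N\<^esub> y') \<ominus>\<^bsub>F\<^esub> (free_gen R (x, y) \<oplus>\<^bsub>F\<^esub> free_gen R (x, y'))"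
  | (smult_left) a x y where "a \<in> carrier R" "x \<in> carrier M" "y \<in> carrier N"
      "r = free_gen R (a \<odot>\<^bsub>M\<^esub> x, y) \<ominus>\<^bsub>F\<^esub> a \<odot>\<^bsub>F\<^esub> free_gen R (x, y)"
  | (smult_right) a x y where "a \<in> carrier R" "x \<in> carrier M" "y \<in> carrier N"
      "r = free_gen R (x, a \<odot>\<^bsub>N\<^esub> y) \<ominus>\<^bsub>F\<^esub> a \<odot>\<^bsub>F\<^esub> free_gen R (x, y)"
  using assms unfolding tensor_relators_def Let_def by blast

text \<open>
  The linear extension of \<open>\<beta>\<close> to the free module on pairs kills the four kinds of relators
  precisely because \<open>\<beta>\<close> is bilinear. Its kernel is a submodule, hence contains their span, and the
  extension factors through the quotient.
\<close>

lemma tensor_product_lift: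
  assumes "module R M" "module R N" "module R P"
    and left: "\<And>y. y \<in> carrier N \<Longrightarrow> (\<lambda>x. \<beta> x y) \<in> linear_maps R M P"
    and right: "\<And>x. x \<in> carrier M \<Longrightarrow> \<beta> x \<in> linear_maps R N P"
  obtains h where "h \<in> linear_maps R (tensor_product R M N) P"
    and "\<And>x y. x \<in> carrier M \<Longrightarrow> y \<in> carrier N \<Longrightarrow> h (pure_tensor R M N x y) = \<beta> x y"
proof -
  interpret M: module R M by fact
  interpret N: module R N by fact
  interpret P: module R P by fact
  let ?F = "free_module R (carrier M \<times> carrier N)"
  let ?K = "tensor_submodule R M N"
  interpret F: module R ?F by (rule M.R.free_module_module)
  note closed = linear_map_closed[OF left]
  have gen: "free_gen R (x, y) \<in> carrier ?F" if "x \<in> carrier M" "y \<in> carrier N" for x y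
    using that by (intro M.R.free_gen_closed) auto
  have rel: "tensor_relators R M N \<subseteq> carrier ?F"
    by (rule subsetI, erule tensor_relators_cases) (simp_all add: gen)
  obtain L where L: "L \<in> linear_maps R ?F P"
    and "\<And>p. p \<in> carrier M \<times> carrier N \<Longrightarrow> L (free_gen R p) = (\<lambda>(x, y). \<beta> x y) p"
    using M.R.free_module_lift[OF assms(3), of "carrier M \<times> carrier N" "\<lambda>(x, y). \<beta> x y"] closed
    by auto
  then have L_gen: "L (free_gen R (x, y)) = \<beta> x y" if "x \<in> carrier M" "y \<in> carrier N" for x y
    using that by simp
  have "L r = \<zero>\<^bsub>P\<^esub>" if "r \<in> tensor_relators R M N" for r
    using that
  proof (cases rule: tensor_relators_cases)
    case (add_left x x' y)
    then show ?thesis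
      using linear_map_add[OF left, of y x x'] closed
      by (simp add: linear_map_minus[OF F.module_axioms P.module_axioms L] linear_map_add[OF L]
          gen L_gen P.M.minus_eq P.M.r_neg)
  next
    case (add_right x y y')
    then show ?thesis
      using linear_map_add[OF right, of x y y'] closed
      by (simp add: linear_map_minus[OF F.module_axioms P.module_axioms L] linear_map_add[OF L]
          gen L_gen P.M.minus_eq P.M.r_neg)
  next
    case (smult_left a x y)
    then show ?thesis
      using linear_map_smult[OF left, of y a x] closed
      by (simp add: linear_map_minus[OF F.module_axioms P.module_axioms L] linear_map_smult[OF L]
          gen L_gen P.M.minus_eq P.M.r_neg)
  next
    case (smult_right a x y)
    then show ?thesis
      using linear_map_smult[OF right, of x a y] closed
      by (simp add: linear_map_minus[OF F.module_axioms P.module_axioms L] linear_map_smult[OF L]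
          gen L_gen P.M.minus_eq P.M.r_neg)
  qed
  with rel have "?K \<subseteq> {f \<in> carrier ?F. L f = \<zero>\<^bsub>P\<^esub>}"
    unfolding tensor_submodule_def
    by (intro span_minimal kernel_submodule[OF F.module_axioms P.module_axioms L]) auto
  then obtain h where "h \<in> linear_maps R (quotient ?F ?K) P"
    and "\<And>f. f \<in> carrier ?F \<Longrightarrow> h (?K +>\<^bsub>?F\<^esub> f) = L f"
    using F.quotient_lift[OF _ P.module_axioms L, of ?K] F.span_submodule[OF rel]
    unfolding tensor_submodule_def by blast
  then show thesis
    using that[of h] by (simp add: tensor_product_def pure_tensor_def gen L_gen)
qed


section \<open>Algebras and their quotients\<close>

text \<open>
  The tensor algebra is not commutative, so the locale \<^locale>\<open>algebra\<close> does not apply to it.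
  Multiplication must then be assumed to respect scalars in both arguments.
\<close>

locale assoc_algebra = module + ring M +
  assumes smult_mult_left:
      "\<lbrakk>a \<in> carrier R; x \<in> carrier M; y \<in> carrier M\<rbrakk> \<Longrightarrow>
        (a \<odot>\<^bsub>M\<^esub> x) \<otimes>\<^bsub>M\<^esub> y = a \<odot>\<^bsub>M\<^esub> (x \<otimes>\<^bsub>M\<^esub> y)"
    and smult_mult_right:
      "\<lbrakk>a \<in> carrier R; x \<in> carrier M; y \<in> carrier M\<rbrakk> \<Longrightarrow>
        x \<otimes>\<^bsub>M\<^esub> (a \<odot>\<^bsub>M\<^esub> y) = a \<odot>\<^bsub>M\<^esub> (x \<otimes>\<^bsub>M\<^esub> y)"

text \<open>
  Generation is phrased as an induction principle: a submodule that contains the unit and is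
  stable under left multiplication by \<open>G\<close> contains all products of elements of \<open>G\<close> and their
  linear combinations. In this form it passes to quotients by taking preimages.
\<close>

definition algebra_generated ::
    "('r, 'p) ring_scheme \<Rightarrow> ('r, 'a, 'm) module_scheme \<Rightarrow> 'a set \<Rightarrow> bool"
  where "algebra_generated R A G \<longleftrightarrow> G \<subseteq> carrier A \<and>
    (\<forall>U. submodule U R A \<and> \<one>\<^bsub>A\<^esub> \<in> U \<and> (\<forall>x\<in>G. \<forall>u\<in>U. x \<otimes>\<^bsub>A\<^esub> u \<in> U) \<longrightarrow> U = carrier A)"

lemma algebra_generatedD:
  assumes "algebra_generated R A G" "submodule U R A" "\<one>\<^bsub>A\<^esub> \<in> U"
    and "\<And>x u. x \<in> G \<Longrightarrow> u \<in> U \<Longrightarrow> x \<otimes>\<^bsub>A\<^esub> u \<in> U"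
  shows "U = carrier A"
  using assms by (auto simp: algebra_generated_def)

context assoc_algebra
begin

text \<open>
  An ideal is stable under scalars because \<open>a \<odot> x = (a \<odot> \<one>) \<otimes> x\<close>.
\<close>

lemma ideal_submodule:
  assumes "ideal I M"
  shows "submodule I R M"
proof -
  interpret I: ideal I M by fact
  have "a \<odot>\<^bsub>M\<^esub> x \<in> I" if "a \<in> carrier R" "x \<in> I" for a x
    using I.I_l_closed[of x "a \<odot>\<^bsub>M\<^esub> \<one>\<^bsub>M\<^esub>"] that by (simp add: smult_mult_left)
  then show ?thesis
    by (intro submodule.intro submodule_axioms.intro I.a_subgroup)
qed

lemma quotient_mult:
  assumes "ideal I M" "x \<in> carrier M" "y \<in> carrier M"
  shows "(I +>\<^bsub>M\<^esub> x) \<otimes>\<^bsub>quotient M I\<^esub> (I +>\<^bsub>M\<^esub> y) = I +>\<^bsub>M\<^esub> (x \<otimes>\<^bsub>M\<^esub> y)"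
  using ideal.rcoset_mult_add[OF assms] by (simp add: quotient_simps)

lemma quotient_assoc_algebra:
  assumes "ideal I M"
  shows "assoc_algebra R (quotient M I)"
proof -
  note I = ideal_submodule[OF assms]
  interpret Q: module R "quotient M I"
    by (rule quotient_module[OF I])
  have "ring (quotient M I)"
    by (intro ringI Q.M.abelian_group_axioms monoidI)
      (auto simp: carrier_quotient quotient_mult[OF assms] quotient_add[OF I] quotient_simps(4)
        m_assoc l_distr r_distr)
  then show ?thesis
    by (intro assoc_algebra.intro Q.module_axioms assoc_algebra_axioms.intro)
      (auto simp: carrier_quotient quotient_mult[OF assms] quotient_smult[OF I]
        smult_mult_left smult_mult_right)
qed

lemma quotient_generated:
  assumes "ideal I M" "algebra_generated R M G"
  shows "algebra_generated R (quotient M I) ((\<lambda>x. I +>\<^bsub>M\<^esub> x) ` G)"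
proof -
  note I = ideal_submodule[OF assms(1)]
  interpret Q: assoc_algebra R "quotient M I"
    by (rule quotient_assoc_algebra[OF assms(1)])
  have "U = carrier (quotient M I)"
    if U: "submodule U R (quotient M I)" "\<one>\<^bsub>quotient M I\<^esub> \<in> U"
      and G: "\<forall>x\<in>G. \<forall>u\<in>U. (I +>\<^bsub>M\<^esub> x) \<otimes>\<^bsub>quotient M I\<^esub> u \<in> U" for U
  proof -
    have GM: "G \<subseteq> carrier M"
      using assms(2) by (simp add: algebra_generated_def)
    define V where "V = {x \<in> carrier M. I +>\<^bsub>M\<^esub> x \<in> U}"
    have zero: "\<zero>\<^bsub>M\<^esub> \<in> V"
      using Q.submoduleE(4)[OF U(1) R.zero_closed U(2)] linear_map_zero[OF module_axioms Q.module_axioms coset_linear[OF I]]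
      by (simp add: V_def)
    have smult: "a \<odot>\<^bsub>M\<^esub> x \<in> V" if "a \<in> carrier R" "x \<in> V" for a x
      using that Q.submoduleE(4)[OF U(1), of a "I +>\<^bsub>M\<^esub> x"] quotient_smult[OF I, of a x]
      by (simp add: V_def)
    have "submodule V R M"
    proof (rule submoduleI)
      show "\<ominus>\<^bsub>M\<^esub> x \<in> V" if "x \<in> V" for x
        using smult[of "\<ominus> \<one>" x] that by (simp add: smult_l_minus V_def)
      show "x \<oplus>\<^bsub>M\<^esub> y \<in> V" if "x \<in> V" "y \<in> V" for x y
        using that Q.submoduleE(5)[OF U(1), of "I +>\<^bsub>M\<^esub> x" "I +>\<^bsub>M\<^esub> y"] quotient_add[OF I, of x y]
        by (simp add: V_def)
    qed (simp_all add: smult zero, simp add: V_def)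
    moreover have "\<one>\<^bsub>M\<^esub> \<in> V"
      using U(2) by (simp add: V_def quotient_simps)
    moreover have "x \<otimes>\<^bsub>M\<^esub> u \<in> V" if "x \<in> G" "u \<in> V" for x u
    proof -
      have "(I +>\<^bsub>M\<^esub> x) \<otimes>\<^bsub>quotient M I\<^esub> (I +>\<^bsub>M\<^esub> u) \<in> U"
        using that G by (simp add: V_def)
      then show ?thesis
        using that GM quotient_mult[OF assms(1), of x u] by (auto simp: V_def)
    qed
    ultimately have "V = carrier M"
      by (rule algebra_generatedD[OF assms(2)])
    then show ?thesis
      using Q.submoduleE(1)[OF U(1)] by (auto simp: carrier_quotient V_def)
  qed
  then show ?thesis
    using assms(2) by (auto simp: algebra_generated_def carrier_quotient)
qed

text \<open>
  The centralizer of \<open>y\<close> is a subalgebra, so it is everything as soon as it contains the generators.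
\<close>

lemma generated_centralizer:
  assumes "algebra_generated R M G" "y \<in> carrier M"
    and "\<And>x. x \<in> G \<Longrightarrow> x \<otimes>\<^bsub>M\<^esub> y = y \<otimes>\<^bsub>M\<^esub> x" and "u \<in> carrier M"
  shows "u \<otimes>\<^bsub>M\<^esub> y = y \<otimes>\<^bsub>M\<^esub> u"
proof -
  have G: "G \<subseteq> carrier M"
    using assms(1) by (simp add: algebra_generated_def)
  define U where "U = {u \<in> carrier M. u \<otimes>\<^bsub>M\<^esub> y = y \<otimes>\<^bsub>M\<^esub> u}"
  have "submodule U R M"
    using assms(2) by (intro submoduleI)
      (auto simp: U_def l_minus r_minus l_distr r_distr smult_mult_left smult_mult_right)
  moreover have "\<one>\<^bsub>M\<^esub> \<in> U"
    using assms(2) by (simp add: U_def)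
  moreover have "x \<otimes>\<^bsub>M\<^esub> u \<in> U" if "x \<in> G" "u \<in> U" for x u
  proof -
    have c: "x \<in> carrier M" "u \<in> carrier M" and u: "u \<otimes>\<^bsub>M\<^esub> y = y \<otimes>\<^bsub>M\<^esub> u"
      using that G by (auto simp: U_def)
    have "(x \<otimes>\<^bsub>M\<^esub> u) \<otimes>\<^bsub>M\<^esub> y = (x \<otimes>\<^bsub>M\<^esub> y) \<otimes>\<^bsub>M\<^esub> u"
      using c u assms(2) by (simp add: m_assoc)
    also have "\<dots> = y \<otimes>\<^bsub>M\<^esub> (x \<otimes>\<^bsub>M\<^esub> u)"
      using c assms(2) assms(3)[OF that(1)] by (simp add: m_assoc)
    finally show ?thesis
      using c by (simp add: U_def)
  qed
  ultimately have "U = carrier M"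
    by (rule algebra_generatedD[OF assms(1)])
  then show ?thesis
    using assms(4) by (auto simp: U_def)
qed

text \<open>
  The centralizer argument is used twice. First every generator is central, since its centralizer
  contains all generators; then every element is central, for the same reason.
\<close>

lemma commuting_generators:
  assumes gen: "algebra_generated R M G"
    and comm: "\<And>x y. x \<in> G \<Longrightarrow> y \<in> G \<Longrightarrow> x \<otimes>\<^bsub>M\<^esub> y = y \<otimes>\<^bsub>M\<^esub> x"
  shows "algebra R M"
proof -
  have G: "G \<subseteq> carrier M"
    using gen by (simp add: algebra_generated_def)
  have "x \<otimes>\<^bsub>M\<^esub> y = y \<otimes>\<^bsub>M\<^esub> x" if "x \<in> G" "y \<in> carrier M" for x y
    using generated_centralizer[OF gen, of x y] comm that G by (metis subsetD)
  then have "x \<otimes>\<^bsub>M\<^esub> y = y \<otimes>\<^bsub>M\<^esub> x" if "x \<in> carrier M" "y \<in> carrier M" for x y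
    using generated_centralizer[OF gen that(2)] that by blast
  then have "cring M"
    by (intro cring.intro ring_axioms comm_monoid.intro monoid_axioms comm_monoid_axioms.intro)
  then show ?thesis
    by (intro algebra.intro module_axioms algebra_axioms.intro smult_mult_left)
qed

end


section \<open>The free and the tensor algebra\<close>

lemma free_algebra_simps:
  "carrier (free_algebra R X) = carrier (free_module R (lists X))"
  "add (free_algebra R X) = add (free_module R (lists X))"
  "zero (free_algebra R X) = zero (free_module R (lists X))"
  "smult (free_algebra R X) = smult (free_module R (lists X))"
  "one (free_algebra R X) = free_gen R []"
  by (simp_all add: free_algebra_def)

context cring
begin

definition word_mult :: "('x list \<Rightarrow> 'a) \<Rightarrow> ('x list \<Rightarrow> 'a) \<Rightarrow> 'x list \<Rightarrow> 'a"
  where "word_mult f g w = (\<Oplus>k\<in>{..length w}. f (take k w) \<otimes> g (drop k w))"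

lemma free_algebra_mult: "mult (free_algebra R X) = word_mult"
  by (simp add: free_algebra_def word_mult_def fun_eq_iff)

text \<open>
  A word splits either before its first letter or after it. With the left derivative
  \<open>\<lambda>v. f (x # v)\<close> in place of \<open>f\<close>, this turns the convolution into a recursion on the word,
  from which the ring laws follow by induction without reindexing any sums.
\<close>

lemma word_mult_Nil:
  assumes "\<And>w. f w \<in> carrier R" "\<And>w. g w \<in> carrier R"
  shows "word_mult f g [] = f [] \<otimes> g []"
  using assms by (simp add: word_mult_def)

lemma word_mult_Cons:
  assumes "\<And>w. f w \<in> carrier R" "\<And>w. g w \<in> carrier R"
  shows "word_mult f g (x # w) = f [] \<otimes> g (x # w) \<oplus> word_mult (\<lambda>v. f (x # v)) g w"
proof -
  have "word_mult f g (x # w) =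
      (\<Oplus>k\<in>{..length w}. f (take (Suc k) (x # w)) \<otimes> g (drop (Suc k) (x # w))) \<oplus> f [] \<otimes> g (x # w)"
    using assms by (simp add: word_mult_def finsum_Suc2 Pi_def del: finsum_Suc take_Suc_Cons drop_Suc_Cons)
  then show ?thesis
    using assms by (simp add: word_mult_def a_comm)
qed

lemma word_mult_closed:
  assumes "\<And>w. f w \<in> carrier R" "\<And>w. g w \<in> carrier R"
  shows "word_mult f g w \<in> carrier R"
  using assms by (simp add: word_mult_def)

lemma word_mult_l_distr:
  assumes "\<And>w. f w \<in> carrier R" "\<And>w. g w \<in> carrier R" "\<And>w. h w \<in> carrier R"
  shows "word_mult (\<lambda>v. f v \<oplus> g v) h w = word_mult f h w \<oplus> word_mult g h w"
  using assms by (simp add: word_mult_def l_distr finsum_addf Pi_def)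

lemma word_mult_r_distr:
  assumes "\<And>w. f w \<in> carrier R" "\<And>w. g w \<in> carrier R" "\<And>w. h w \<in> carrier R"
  shows "word_mult f (\<lambda>v. g v \<oplus> h v) w = word_mult f g w \<oplus> word_mult f h w"
  using assms by (simp add: word_mult_def r_distr finsum_addf Pi_def)

lemma word_mult_smult_left:
  assumes "\<And>w. f w \<in> carrier R" "\<And>w. g w \<in> carrier R" "a \<in> carrier R"
  shows "word_mult (\<lambda>v. a \<otimes> f v) g w = a \<otimes> word_mult f g w"
  using assms by (simp add: word_mult_def m_assoc finsum_rdistr Pi_def)

lemma word_mult_smult_right:
  assumes "\<And>w. f w \<in> carrier R" "\<And>w. g w \<in> carrier R" "a \<in> carrier R"
  shows "word_mult f (\<lambda>v. a \<otimes> g v) w = a \<otimes> word_mult f g w"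
  using assms by (simp add: word_mult_def m_lcomm finsum_rdistr Pi_def)

lemma word_mult_assoc:
  assumes "\<And>w. f w \<in> carrier R" "\<And>w. g w \<in> carrier R" "\<And>w. h w \<in> carrier R"
  shows "word_mult (word_mult f g) h w = word_mult f (word_mult g h) w"
  using assms
proof (induction w arbitrary: f g)
  case Nil
  then show ?case
    by (simp add: word_mult_Nil word_mult_closed m_assoc)
next
  case (Cons x w)
  let ?f = "\<lambda>v. f (x # v)" and ?g = "\<lambda>v. g (x # v)"
  note closed = Cons.prems
  have "(\<lambda>v. word_mult f g (x # v)) = (\<lambda>v. f [] \<otimes> ?g v \<oplus> word_mult ?f g v)"
    using closed by (simp add: word_mult_Cons)
  then have "word_mult (\<lambda>v. word_mult f g (x # v)) h w
      = f [] \<otimes> word_mult ?g h w \<oplus> word_mult (word_mult ?f g) h w"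
    using closed by (simp add: word_mult_l_distr word_mult_smult_left word_mult_closed)
  also have "word_mult (word_mult ?f g) h w = word_mult ?f (word_mult g h) w"
    using closed by (intro Cons.IH)
  finally show ?case
    using closed by (simp add: word_mult_Cons word_mult_Nil word_mult_closed r_distr m_assoc a_assoc)
qed

lemma free_gen_in_carrier: "free_gen R x y \<in> carrier R"
  by (simp add: free_gen_def)

lemma word_mult_zero_left:
  assumes "\<And>w. g w \<in> carrier R"
  shows "word_mult (\<lambda>_. \<zero>) g w = \<zero>"
  using assms by (simp add: word_mult_def)

lemma word_mult_one_left:
  assumes "\<And>w. g w \<in> carrier R"
  shows "word_mult (free_gen R []) g = g"
proof
  have "(\<lambda>v. free_gen R [] (x # v)) = (\<lambda>_. \<zero>)" for x
    by (simp add: free_gen_def)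
  then show "word_mult (free_gen R []) g w = g w" for w
    using assms by (cases w)
      (simp_all add: word_mult_Nil word_mult_Cons free_gen_in_carrier,
        simp_all add: free_gen_def word_mult_zero_left)
qed

lemma word_mult_one_right:
  assumes "\<And>w. f w \<in> carrier R"
  shows "word_mult f (free_gen R []) w = f w"
  using assms
proof (induction w arbitrary: f)
  case Nil
  then show ?case
    by (simp add: word_mult_Nil free_gen_in_carrier) (simp add: free_gen_def)
next
  case (Cons x w)
  then show ?case
    by (simp add: word_mult_Cons free_gen_in_carrier) (simp add: free_gen_def)
qed

lemma word_mult_free_gen: "word_mult (free_gen R [x]) (free_gen R w) = free_gen R (x # w)"
proof
  have "(\<lambda>v. free_gen R [x] (y # v)) = (if y = x then free_gen R [] else (\<lambda>_. \<zero>))" for y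
    by (auto simp: free_gen_def)
  then show "word_mult (free_gen R [x]) (free_gen R w) v = free_gen R (x # w) v" for v
    by (cases v) (simp_all add: word_mult_Nil word_mult_Cons word_mult_zero_left
        word_mult_one_left free_gen_in_carrier, simp_all add: free_gen_def)
qed

text \<open>
  A word in the support of a product is the concatenation of a word in the support of each factor,
  so finite support is inherited.
\<close>

lemma word_mult_free_algebra:
  assumes "f \<in> carrier (free_algebra R X)" "g \<in> carrier (free_algebra R X)"
  shows "word_mult f g \<in> carrier (free_algebra R X)"
proof -
  have f: "f \<in> carrier (free_module R (lists X))" and g: "g \<in> carrier (free_module R (lists X))"
    using assms by (simp_all add: free_algebra_simps)
  note closed = free_module_closed[OF f] free_module_closed[OF g]
  have nz: "\<exists>k. f (take k w) \<noteq> \<zero> \<and> g (drop k w) \<noteq> \<zero>" if "word_mult f g w \<noteq> \<zero>" for w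
  proof (rule ccontr)
    assume "\<not> ?thesis"
    then have "f (take k w) \<otimes> g (drop k w) = \<zero>" for k
      using closed by (metis l_null r_null)
    then show False
      using that by (simp add: word_mult_def)
  qed
  show ?thesis
    unfolding free_algebra_simps
  proof (rule free_moduleI)
    show "word_mult f g w \<in> carrier R" for w
      using closed by (rule word_mult_closed)
    show "word_mult f g w = \<zero>" if "w \<notin> lists X" for w
    proof (rule ccontr)
      assume "word_mult f g w \<noteq> \<zero>"
      then obtain k where "f (take k w) \<noteq> \<zero>" "g (drop k w) \<noteq> \<zero>"
        using nz by blast
      then have "take k w \<in> lists X" "drop k w \<in> lists X"
        using free_moduleD(2)[OF f] free_moduleD(2)[OF g] by blast+
      then have "take k w @ drop k w \<in> lists X"
        unfolding append_in_lists_conv by blast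
      with that show False by simp
    qed
    show "{w. word_mult f g w \<noteq> \<zero>} \<subseteq> (\<lambda>(u, v). u @ v) ` ({u. f u \<noteq> \<zero>} \<times> {v. g v \<noteq> \<zero>})"
    proof
      fix w assume "w \<in> {w. word_mult f g w \<noteq> \<zero>}"
      then obtain k where "f (take k w) \<noteq> \<zero>" "g (drop k w) \<noteq> \<zero>"
        using nz by blast
      then show "w \<in> (\<lambda>(u, v). u @ v) ` ({u. f u \<noteq> \<zero>} \<times> {v. g v \<noteq> \<zero>})"
        by (intro image_eqI[of _ _ "(take k w, drop k w)"]) auto
    qed
    show "finite ((\<lambda>(u, v). u @ v) ` ({u. f u \<noteq> \<zero>} \<times> {v. g v \<noteq> \<zero>}))"
      using free_moduleD(3)[OF f] free_moduleD(3)[OF g] by simp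
  qed
qed

lemma free_algebra_module: "module R (free_algebra R X)"
proof -
  interpret F: module R "free_module R (lists X)"
    by (rule free_module_module)
  have "abelian_group (free_algebra R X)"
    by (rule abelian_groupI)
      (auto simp: free_algebra_simps F.M.a_ac intro: F.M.l_neg F.M.a_inv_closed)
  then show ?thesis
    by (intro moduleI)
      (simp_all add: free_algebra_simps cring_axioms F.smult_l_distr F.smult_r_distr F.smult_assoc1)
qed

lemma free_algebra_assoc_algebra: "assoc_algebra R (free_algebra R X)"
proof -
  let ?F = "free_algebra R X"
  interpret F: module R ?F
    by (rule free_algebra_module)
  have closed: "f w \<in> carrier R" if "f \<in> carrier ?F" for f w
    using that by (simp add: free_algebra_simps free_module_closed)
  have add: "f \<oplus>\<^bsub>?F\<^esub> g = (\<lambda>w. f w \<oplus> g w)" for f g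
    by (simp add: free_algebra_simps free_module_simps)
  have smult: "a \<odot>\<^bsub>?F\<^esub> f = (\<lambda>w. a \<otimes> f w)" for a f
    by (simp add: free_algebra_simps free_module_simps)
  have one: "\<one>\<^bsub>?F\<^esub> \<in> carrier ?F"
    by (simp add: free_algebra_simps free_gen_closed)
  have "monoid ?F"
    by (rule monoidI)
      (simp_all add: one free_algebra_mult word_mult_free_algebra word_mult_assoc closed fun_eq_iff,
        simp_all add: free_algebra_simps(5) word_mult_one_left word_mult_one_right closed)
  moreover have "(f \<oplus>\<^bsub>?F\<^esub> g) \<otimes>\<^bsub>?F\<^esub> h = f \<otimes>\<^bsub>?F\<^esub> h \<oplus>\<^bsub>?F\<^esub> g \<otimes>\<^bsub>?F\<^esub> h"
    and "h \<otimes>\<^bsub>?F\<^esub> (f \<oplus>\<^bsub>?F\<^esub> g) = h \<otimes>\<^bsub>?F\<^esub> f \<oplus>\<^bsub>?F\<^esub> h \<otimes>\<^bsub>?F\<^esub> g"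
    if "f \<in> carrier ?F" "g \<in> carrier ?F" "h \<in> carrier ?F" for f g h
    using closed[OF that(1)] closed[OF that(2)] closed[OF that(3)]
    by (simp_all add: add free_algebra_mult fun_eq_iff word_mult_l_distr word_mult_r_distr)
  ultimately have "ring ?F"
    by (intro ringI F.M.abelian_group_axioms)
  moreover have "(a \<odot>\<^bsub>?F\<^esub> f) \<otimes>\<^bsub>?F\<^esub> g = a \<odot>\<^bsub>?F\<^esub> (f \<otimes>\<^bsub>?F\<^esub> g)"
    and "f \<otimes>\<^bsub>?F\<^esub> (a \<odot>\<^bsub>?F\<^esub> g) = a \<odot>\<^bsub>?F\<^esub> (f \<otimes>\<^bsub>?F\<^esub> g)"
    if "a \<in> carrier R" "f \<in> carrier ?F" "g \<in> carrier ?F" for a f g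
    using that(1) closed[OF that(2)] closed[OF that(3)]
    by (simp_all add: smult free_algebra_mult fun_eq_iff word_mult_smult_left word_mult_smult_right)
  ultimately show ?thesis
    by (intro assoc_algebra.intro assoc_algebra_axioms.intro F.module_axioms)
qed

text \<open>
  The free module on words is spanned by the words, and a word is built from the empty word by
  multiplying with its letters from the left.
\<close>

lemma free_algebra_generated:
  "algebra_generated R (free_algebra R X) ((\<lambda>x. free_gen R [x]) ` X)"
proof -
  let ?F = "free_algebra R X"
  have "U = carrier ?F"
    if U: "submodule U R ?F" "\<one>\<^bsub>?F\<^esub> \<in> U" "\<forall>x\<in>X. \<forall>u\<in>U. free_gen R [x] \<otimes>\<^bsub>?F\<^esub> u \<in> U" for U
  proof -
    have "free_gen R w \<in> U" if "w \<in> lists X" for w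
      using that
    proof (induction w)
      case Nil
      then show ?case
        using U(2) by (simp add: free_algebra_simps)
    next
      case (Cons x w)
      then show ?case
        using U(3) by (metis free_algebra_mult word_mult_free_gen)
    qed
    moreover have "submodule U R (free_module R (lists X))"
      using U(1) by (simp add: submodule_def subgroup_def submodule_axioms_def free_algebra_simps
          m_inv_def)
    ultimately show ?thesis
      using free_module_generated[of U "lists X"] by (simp add: free_algebra_simps)
  qed
  then show ?thesis
    by (auto simp: algebra_generated_def free_algebra_simps intro: free_gen_closed)
qed

end


context module
begin

text \<open>
  The generators of the ideal are the differences that express linearity of \<open>x \<mapsto> [x]\<close>; modulo
  the ideal this map is therefore linear.
\<close>

lemma tensor_algebra_ideal: "ideal (tensor_algebra_ideal R M) (free_algebra R (carrier M))" (is ?ideal)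
  and tensor_algebra_incl_linear: "tensor_algebra_incl R M \<in> linear_maps R M (tensor_algebra R M)" (is ?linear)
proof -
  let ?F = "free_algebra R (carrier M)" and ?I = "tensor_algebra_ideal R M"
  interpret F: assoc_algebra R ?F
    by (rule R.free_algebra_assoc_algebra)
  define rel where "rel =
      {free_gen R [x \<oplus>\<^bsub>M\<^esub> y] \<ominus>\<^bsub>?F\<^esub> (free_gen R [x] \<oplus>\<^bsub>?F\<^esub> free_gen R [y]) | x y.
        x \<in> carrier M \<and> y \<in> carrier M} \<union>
      {free_gen R [a \<odot>\<^bsub>M\<^esub> x] \<ominus>\<^bsub>?F\<^esub> a \<odot>\<^bsub>?F\<^esub> free_gen R [x] | a x.
        a \<in> carrier R \<and> x \<in> carrier M}"
  have gen: "free_gen R [x] \<in> carrier ?F" if "x \<in> carrier M" for x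
    using that by (auto simp: free_algebra_simps intro: R.free_gen_closed)
  have I: "?I = genideal ?F rel"
    by (simp add: tensor_algebra_ideal_def rel_def Let_def)
  have rel: "rel \<subseteq> carrier ?F"
    by (auto simp: rel_def gen)
  then show ?ideal
    unfolding I by (rule F.genideal_ideal)
  then have S: "submodule ?I R ?F"
    by (rule F.ideal_submodule)
  have relI: "r \<in> ?I" if "r \<in> rel" for r
    using that F.genideal_self[OF rel] by (auto simp: I)
  have incl: "tensor_algebra_incl R M x = ?I +>\<^bsub>?F\<^esub> free_gen R [x]" for x
    by (simp add: tensor_algebra_incl_def)
  have add: "?I +>\<^bsub>?F\<^esub> free_gen R [x \<oplus>\<^bsub>M\<^esub> y] = ?I +>\<^bsub>?F\<^esub> (free_gen R [x] \<oplus>\<^bsub>?F\<^esub> free_gen R [y])"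
    if "x \<in> carrier M" "y \<in> carrier M" for x y
    using that by (intro F.coset_eqI[OF S] relI) (auto simp: gen rel_def)
  have smult: "?I +>\<^bsub>?F\<^esub> free_gen R [a \<odot>\<^bsub>M\<^esub> x] = ?I +>\<^bsub>?F\<^esub> (a \<odot>\<^bsub>?F\<^esub> free_gen R [x])"
    if "a \<in> carrier R" "x \<in> carrier M" for a x
    using that by (intro F.coset_eqI[OF S] relI) (auto simp: gen rel_def)
  show ?linear
    unfolding tensor_algebra_def
    by (intro linear_mapsI)
      (auto simp: carrier_quotient incl gen add smult F.quotient_add[OF S] F.quotient_smult[OF S])
qed

lemma tensor_algebra_assoc_algebra: "assoc_algebra R (tensor_algebra R M)"
  unfolding tensor_algebra_def
  by (rule assoc_algebra.quotient_assoc_algebra[OF R.free_algebra_assoc_algebra tensor_algebra_ideal])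

lemma tensor_algebra_generated:
  "algebra_generated R (tensor_algebra R M) (tensor_algebra_incl R M ` carrier M)"
  using assoc_algebra.quotient_generated[OF R.free_algebra_assoc_algebra tensor_algebra_ideal
      R.free_algebra_generated]
  by (simp add: tensor_algebra_def tensor_algebra_incl_def image_image)
end


section \<open>The symmetric algebra\<close>

context module
begin

text \<open>
  The ideal only makes the letters commute, but the letters generate the tensor algebra, and hence
  its quotient, so the whole quotient is commutative.
\<close>

lemma sym_algebra_algebra: "algebra R (sym_algebra R M)" (is ?algebra)
  and sym_incl_linear: "sym_incl R M \<in> linear_maps R M (sym_algebra R M)" (is ?linear)
proof -
  let ?T = "tensor_algebra R M" and ?j = "tensor_algebra_incl R M" and ?J = "sym_ideal R M"
  interpret T: assoc_algebra R ?T
    by (rule tensor_algebra_assoc_algebra)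
  define rel where "rel = {?j x \<otimes>\<^bsub>?T\<^esub> ?j y \<ominus>\<^bsub>?T\<^esub> ?j y \<otimes>\<^bsub>?T\<^esub> ?j x | x y.
      x \<in> carrier M \<and> y \<in> carrier M}"
  have j: "?j x \<in> carrier ?T" if "x \<in> carrier M" for x
    using linear_map_closed[OF tensor_algebra_incl_linear that] .
  have J: "?J = genideal ?T rel"
    by (simp add: sym_ideal_def rel_def Let_def)
  have rel: "rel \<subseteq> carrier ?T"
    by (auto simp: rel_def j)
  then have ideal: "ideal ?J ?T"
    unfolding J by (rule T.genideal_ideal)
  note S = T.ideal_submodule[OF ideal]
  have incl: "sym_incl R M = (\<lambda>x. ?J +>\<^bsub>?T\<^esub> ?j x)"
    by (simp add: sym_incl_def fun_eq_iff)
  show ?linear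
    unfolding sym_algebra_def incl
    by (rule linear_map_comp[OF tensor_algebra_incl_linear T.coset_linear[OF S]])
  interpret Sym: assoc_algebra R "sym_algebra R M"
    unfolding sym_algebra_def by (rule T.quotient_assoc_algebra[OF ideal])
  have "algebra_generated R (sym_algebra R M) (sym_incl R M ` carrier M)"
    using T.quotient_generated[OF ideal tensor_algebra_generated]
    by (simp add: sym_algebra_def incl image_image)
  moreover have "sym_incl R M x \<otimes>\<^bsub>sym_algebra R M\<^esub> sym_incl R M y
      = sym_incl R M y \<otimes>\<^bsub>sym_algebra R M\<^esub> sym_incl R M x"
    if "x \<in> carrier M" "y \<in> carrier M" for x y
  proof -
    have "?j x \<otimes>\<^bsub>?T\<^esub> ?j y \<ominus>\<^bsub>?T\<^esub> ?j y \<otimes>\<^bsub>?T\<^esub> ?j x \<in> ?J"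
      using that T.genideal_self[OF rel] by (auto simp: J rel_def)
    then have "?J +>\<^bsub>?T\<^esub> (?j x \<otimes>\<^bsub>?T\<^esub> ?j y) = ?J +>\<^bsub>?T\<^esub> (?j y \<otimes>\<^bsub>?T\<^esub> ?j x)"
      using that j by (intro T.coset_eqI[OF S]) auto
    then show ?thesis
      using that j by (simp add: sym_algebra_def incl T.quotient_mult[OF ideal])
  qed
  ultimately show ?algebra
    by (intro Sym.commuting_generators) auto
qed

end


section \<open>Linear relations between grouplike elements\<close>

context coalgebra
begin

text \<open>
  Composing \<open>\<Delta>\<close> with the linear map \<open>x \<otimes> y \<mapsto> f x \<otimes> h y\<close> gives the convolution product of \<open>f\<close> and
  \<open>h\<close>. Since \<open>\<Delta> x = x \<otimes> x\<close> for grouplike \<open>x\<close>, it is the pointwise product there: a quadratic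
  expression in \<open>x\<close> agrees with a linear one on all grouplike elements.
\<close>

lemma convolution:
  assumes "algebra R A" "f \<in> linear_maps R C A" "h \<in> linear_maps R C A"
  obtains k where "k \<in> linear_maps R C A"
    and "\<And>x. grouplike R C \<Delta> \<epsilon> x \<Longrightarrow> k x = f x \<otimes>\<^bsub>A\<^esub> h x"
proof -
  interpret A: algebra R A by fact
  note f = linear_mapsD[OF assms(2)] and h = linear_mapsD[OF assms(3)]
  obtain \<mu> where \<mu>: "\<mu> \<in> linear_maps R (tensor_product R C C) A"
    and \<mu>_pure: "\<And>x y. x \<in> carrier C \<Longrightarrow> y \<in> carrier C \<Longrightarrow>
      \<mu> (pure_tensor R C C x y) = f x \<otimes>\<^bsub>A\<^esub> h y"
  proof (rule tensor_product_lift[where R = R and M = C and N = C and P = A and \<beta> = "\<lambda>x y. f x \<otimes>\<^bsub>A\<^esub> h y"])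
    show "(\<lambda>x. f x \<otimes>\<^bsub>A\<^esub> h y) \<in> linear_maps R C A" if "y \<in> carrier C" for y
      using that by (intro linear_mapsI) (simp_all add: f h A.l_distr A.smult_assoc2)
    show "(\<lambda>y. f x \<otimes>\<^bsub>A\<^esub> h y) \<in> linear_maps R C A" if "x \<in> carrier C" for x
      using that A.smult_assoc2[of _ _ "f x"]
      by (intro linear_mapsI) (simp_all add: f h A.r_distr A.m_comm)
  qed (auto simp: f h intro: module_axioms A.module)
  show thesis
  proof (rule that)
    show "(\<lambda>x. \<mu> (\<Delta> x)) \<in> linear_maps R C A"
      by (rule linear_map_comp[OF comult_linear \<mu>])
  qed (simp add: grouplike_def \<mu>_pure)
qed

text \<open>
  The polynomial \<open>\<Prod>\<^sub>j (t - a j)\<close>, evaluated at \<open>\<iota> x\<close>, agrees on grouplike elements with a linear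
  function of \<open>x\<close>. Each factor does, because the constant \<open>a j\<close> can be written as \<open>\<epsilon> x \<odot> a j\<close> when
  \<open>\<epsilon> x = \<one>\<close>, and convolution multiplies the factors.
\<close>

lemma product_of_differences_linear:
  assumes "algebra R A" "\<iota> \<in> linear_maps R C A" "finite S" "a \<in> S \<rightarrow> carrier A"
  obtains k where "k \<in> linear_maps R C A"
    and "\<And>x. grouplike R C \<Delta> \<epsilon> x \<Longrightarrow> k x = (\<Otimes>\<^bsub>A\<^esub>j\<in>S. \<iota> x \<ominus>\<^bsub>A\<^esub> a j)"
proof -
  interpret A: algebra R A by fact
  note \<iota> = linear_mapsD[OF assms(2)]
  have \<epsilon>: "\<epsilon> x \<in> carrier R" "\<epsilon> (x \<oplus>\<^bsub>C\<^esub> y) = \<epsilon> x \<oplus> \<epsilon> y" "b \<in> carrier R \<Longrightarrow> \<epsilon> (b \<odot>\<^bsub>C\<^esub> x) = b \<otimes> \<epsilon> x"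
    if "x \<in> carrier C" "y \<in> carrier C" for x y b
    using that counit_linear by (auto simp: linear_maps_def regular_module_def)
  have unit: "(\<lambda>x. \<epsilon> x \<odot>\<^bsub>A\<^esub> b) \<in> linear_maps R C A" if "b \<in> carrier A" for b
    using that by (intro linear_mapsI) (auto simp: \<epsilon> A.smult_l_distr A.smult_assoc1)
  have "\<exists>k\<in>linear_maps R C A. \<forall>x. grouplike R C \<Delta> \<epsilon> x \<longrightarrow> k x = (\<Otimes>\<^bsub>A\<^esub>j\<in>S. \<iota> x \<ominus>\<^bsub>A\<^esub> a j)"
    using assms(3,4)
  proof (induction S)
    case empty
    show ?case
      using unit[OF A.one_closed] by (intro bexI) (auto simp: grouplike_def)
  next
    case (insert i S)
    then obtain k where k: "k \<in> linear_maps R C A"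
      and k_eq: "\<And>x. grouplike R C \<Delta> \<epsilon> x \<Longrightarrow> k x = (\<Otimes>\<^bsub>A\<^esub>j\<in>S. \<iota> x \<ominus>\<^bsub>A\<^esub> a j)"
      by auto
    have ai: "a i \<in> carrier A"
      using insert.prems by auto
    note u = linear_mapsD[OF unit[OF ai]]
    \<comment> \<open>The factor \<open>t - a i\<close>, made linear by writing its constant term as \<open>\<epsilon> x \<odot> a i\<close>.\<close>
    have "(\<lambda>x. \<iota> x \<ominus>\<^bsub>A\<^esub> \<epsilon> x \<odot>\<^bsub>A\<^esub> a i) \<in> linear_maps R C A"
    proof (rule linear_mapsI)
      fix x assume x: "x \<in> carrier C"
      show "\<iota> x \<ominus>\<^bsub>A\<^esub> \<epsilon> x \<odot>\<^bsub>A\<^esub> a i \<in> carrier A"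
        using x by (simp add: \<iota> u)
      show "\<iota> (b \<odot>\<^bsub>C\<^esub> x) \<ominus>\<^bsub>A\<^esub> \<epsilon> (b \<odot>\<^bsub>C\<^esub> x) \<odot>\<^bsub>A\<^esub> a i = b \<odot>\<^bsub>A\<^esub> (\<iota> x \<ominus>\<^bsub>A\<^esub> \<epsilon> x \<odot>\<^bsub>A\<^esub> a i)"
        if "b \<in> carrier R" for b
        using x that by (simp add: \<iota> u A.minus_eq A.smult_r_distr A.smult_r_minus)
      show "\<iota> (x \<oplus>\<^bsub>C\<^esub> y) \<ominus>\<^bsub>A\<^esub> \<epsilon> (x \<oplus>\<^bsub>C\<^esub> y) \<odot>\<^bsub>A\<^esub> a i
          = (\<iota> x \<ominus>\<^bsub>A\<^esub> \<epsilon> x \<odot>\<^bsub>A\<^esub> a i) \<oplus>\<^bsub>A\<^esub> (\<iota> y \<ominus>\<^bsub>A\<^esub> \<epsilon> y \<odot>\<^bsub>A\<^esub> a i)"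
        if "y \<in> carrier C" for y
        using x that by (simp add: \<iota> u A.minus_eq A.minus_add A.a_ac)
    qed
    then obtain k' where k': "k' \<in> linear_maps R C A"
      and k'_eq: "\<And>x. grouplike R C \<Delta> \<epsilon> x \<Longrightarrow> k' x = (\<iota> x \<ominus>\<^bsub>A\<^esub> \<epsilon> x \<odot>\<^bsub>A\<^esub> a i) \<otimes>\<^bsub>A\<^esub> k x"
      using convolution[OF assms(1) _ k] by blast
    have "k' x = (\<Otimes>\<^bsub>A\<^esub>j\<in>insert i S. \<iota> x \<ominus>\<^bsub>A\<^esub> a j)" if x: "grouplike R C \<Delta> \<epsilon> x" for x
    proof -
      have "\<iota> x \<in> carrier A" "\<epsilon> x = \<one>"
        using x \<iota> by (auto simp: grouplike_def)
      then show ?thesis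
        using insert.hyps insert.prems ai by (simp add: k'_eq[OF x] k_eq[OF x] Pi_def)
    qed
    with k' show ?case by blast
  qed
  then show thesis
    using that by blast
qed

text \<open>
  Apply to the relation the linear map that agrees with \<open>x \<mapsto> \<Prod>\<^sub>j (\<iota> x - \<iota> (g j))\<close>, \<open>j \<noteq> i\<close>, on grouplike
  elements. Every summand other than the one for \<open>i\<close> disappears, since it has a factor
  \<open>\<iota> (g l) - \<iota> (g l)\<close>. The target can be any commutative algebra.
\<close>

lemma grouplike_relation:
  assumes A: "algebra R A" and \<iota>: "\<iota> \<in> linear_maps R C A" and "finite S"
    and g: "\<And>i. i \<in> S \<Longrightarrow> grouplike R C \<Delta> \<epsilon> (g i)"
    and c: "\<And>i. i \<in> S \<Longrightarrow> c i \<in> carrier R"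
    and relation: "(\<Oplus>\<^bsub>C\<^esub>i\<in>S. c i \<odot>\<^bsub>C\<^esub> g i) = \<zero>\<^bsub>C\<^esub>"
    and i: "i \<in> S"
  shows "c i \<odot>\<^bsub>A\<^esub> (\<Otimes>\<^bsub>A\<^esub>j\<in>S - {i}. \<iota> (g i) \<ominus>\<^bsub>A\<^esub> \<iota> (g j)) = \<zero>\<^bsub>A\<^esub>"
proof -
  interpret A: algebra R A by fact
  have gC: "g j \<in> carrier C" if "j \<in> S" for j
    using g[OF that] by (simp add: grouplike_def)
  note \<iota>g = linear_map_closed[OF \<iota> gC]
  let ?P = "\<lambda>l. \<Otimes>\<^bsub>A\<^esub>j\<in>S - {i}. \<iota> (g l) \<ominus>\<^bsub>A\<^esub> \<iota> (g j)"
  have fin: "finite (S - {i})" "(\<lambda>j. \<iota> (g j)) \<in> S - {i} \<rightarrow> carrier A"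
    using \<open>finite S\<close> \<iota>g by auto
  obtain k where k: "k \<in> linear_maps R C A"
    and k_eq: "\<And>x. grouplike R C \<Delta> \<epsilon> x \<Longrightarrow> k x = (\<Otimes>\<^bsub>A\<^esub>j\<in>S - {i}. \<iota> x \<ominus>\<^bsub>A\<^esub> \<iota> (g j))"
    using product_of_differences_linear[OF A \<iota> fin] by blast
  have P: "?P l \<in> carrier A" if "l \<in> S" for l
    using that \<iota>g by (intro A.finprod_closed) auto
  have vanish: "?P l = \<zero>\<^bsub>A\<^esub>" if l: "l \<in> S - {i}" for l
  proof -
    have "?P l = (\<iota> (g l) \<ominus>\<^bsub>A\<^esub> \<iota> (g l)) \<otimes>\<^bsub>A\<^esub> (\<Otimes>\<^bsub>A\<^esub>j\<in>S - {i} - {l}. \<iota> (g l) \<ominus>\<^bsub>A\<^esub> \<iota> (g j))"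
      using A.finprod_insert[of "S - {i} - {l}" l "\<lambda>j. \<iota> (g l) \<ominus>\<^bsub>A\<^esub> \<iota> (g j)"] l fin(1) \<iota>g
      by (simp add: insert_absorb Pi_def)
    moreover have "(\<Otimes>\<^bsub>A\<^esub>j\<in>S - {i} - {l}. \<iota> (g l) \<ominus>\<^bsub>A\<^esub> \<iota> (g j)) \<in> carrier A"
      using l \<iota>g by (intro A.finprod_closed) auto
    ultimately show ?thesis
      using l \<iota>g by (simp add: A.minus_eq A.r_neg)
  qed
  have "\<zero>\<^bsub>A\<^esub> = k (\<Oplus>\<^bsub>C\<^esub>l\<in>S. c l \<odot>\<^bsub>C\<^esub> g l)"
    using linear_map_zero[OF module_axioms A.module k] relation by simp
  also have "\<dots> = (\<Oplus>\<^bsub>A\<^esub>l\<in>S. k (c l \<odot>\<^bsub>C\<^esub> g l))"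
    using \<open>finite S\<close> c gC by (intro linear_map_finsum[OF module_axioms A.module k]) auto
  also have "\<dots> = (\<Oplus>\<^bsub>A\<^esub>l\<in>S. if i = l then c l \<odot>\<^bsub>A\<^esub> ?P l else \<zero>\<^bsub>A\<^esub>)"
  proof (rule A.finsum_cong')
    fix l assume l: "l \<in> S"
    have "k (c l \<odot>\<^bsub>C\<^esub> g l) = c l \<odot>\<^bsub>A\<^esub> ?P l"
      using l c gC g by (simp add: linear_map_smult[OF k] k_eq)
    then show "k (c l \<odot>\<^bsub>C\<^esub> g l) = (if i = l then c l \<odot>\<^bsub>A\<^esub> ?P l else \<zero>\<^bsub>A\<^esub>)"
      using l c vanish[of l] by auto
  qed (use c P in auto)
  also have "\<dots> = c i \<odot>\<^bsub>A\<^esub> ?P i"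
    using i \<open>finite S\<close> c P by (intro A.finsum_singleton) auto
  finally show ?thesis by simp
qed

end

theorem theorem3p2:
  fixes R :: "('r, 'p) ring_scheme" and C :: "('r, 'c, 'm) module_scheme"
    and \<Delta> :: "'c \<Rightarrow> ('c \<times> 'c \<Rightarrow> 'r) set" and \<epsilon> :: "'c \<Rightarrow> 'r"
    and n :: nat and g :: "nat \<Rightarrow> 'c" and c :: "nat \<Rightarrow> 'r"
  assumes "cring R"
    and "coalgebra R C \<Delta> \<epsilon>"
    and "\<And>i. i \<in> {1..n} \<Longrightarrow> grouplike R C \<Delta> \<epsilon> (g i)"
    and "\<And>i. i \<in> {1..n} \<Longrightarrow> c i \<in> carrier R"
    and "(\<Oplus>\<^bsub>C\<^esub>i\<in>{1..n}. c i \<odot>\<^bsub>C\<^esub> g i) = \<zero>\<^bsub>C\<^esub>"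
  shows "\<forall>i\<in>{1..n}.
    c i \<odot>\<^bsub>sym_algebra R C\<^esub>
      (\<Otimes>\<^bsub>sym_algebra R C\<^esub>j\<in>{1..n} - {i}.
        sym_incl R C (g i) \<ominus>\<^bsub>sym_algebra R C\<^esub> sym_incl R C (g j))
    = \<zero>\<^bsub>sym_algebra R C\<^esub>"
proof -
  interpret coalgebra R C \<Delta> \<epsilon> by fact
  show ?thesis
    using assms(3-5)
    by (intro ballI grouplike_relation[OF sym_algebra_algebra sym_incl_linear]) auto
qed

end
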